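(* The formulas $\mathrm{PebHint}(P_h)\circ\mathrm{OR}$, where $P_h$ is the pyramid graph of height $h$ with $n=\Theta(h^2)$ vertices, have MaxRes refutations of size $\Theta(n)$.
   Context: Pyramid graph $P_h$: the directed acyclic graph with layers $0,1,\dots,h$, where layer $i$ has vertices $(i,0),\dots,(i,h-i)$, and edges from $(i,j)$ and $(i,j+1)$ to $(i+1,j)$. The sources are the vertices of layer $0$ and the unique sink is $(h,0)$. The predecessors of a vertex are the origins of its incoming edges. Two vertices $u,v$ are siblings if they are incomparable (neither is reachable from the other) and have a common predecessor. For a DAG $G$ with single sink $z$ in which each non-source vertex has two predecessors, $\mathrm{PebHint}(G)\circ\mathrm{OR}$ has variables $v_1,v_2$ for each vertex $v$ and the following clauses: $v_1\vee v_2$ for each source $v$; for each internal vertex $w$ with predecessors $u,v$, the four clauses $\overline{u_a}\vee\overline{v_b}\vee w_1\vee w_2$ with $a,b\in\{1,2\}$; the clauses $\overline{z_1}$ and $\overline{z_2}$; and $u_1\vee u_2\vee v_1\vee v_2$ for each pair of siblings $(u,v)$. MaxSAT resolution rule: from $x\vee A$ and $\overline{x}\vee B$ with $A=a_1\vee\dots\vee a_s$, $B=b_1\vee\dots\vee b_t$, derive $A\vee B$; the clauses $x\vee A\vee b_1\vee\dots\vee b_{j-1}\vee\overline{b_j}$ for $1\le j\le t$; and the clauses $\overline{x}\vee B\vee a_1\vee\dots\vee a_{j-1}\vee\overline{a_j}$ for $1\le j\le s$. When the rule is applied to a multi-set of clauses, (one copy of) each antecedent is removed and all non-tautologous consequents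 are added. A MaxRes refutation of $F$ is a sequence of multi-sets $F=F_0,\dots,F_s$, each obtained from the previous one by one application of the MaxSAT resolution rule, with $F_s$ containing the empty clause; its size is $s$. *)

theory Defs
  imports Complex_Main "HOL-Library.Multiset" "HOL-Library.Landau_Symbols"
begin

section \<open>Clauses and MaxSAT resolution\<close>

datatype 'x literal = Pos 'x | Neg 'x

fun compl :: "'x literal \<Rightarrow> 'x literal" where
  "compl (Pos x) = Neg x"
| "compl (Neg x) = Pos x"

type_synonym 'x clause = "'x literal set"

definition tautologous :: "'x clause \<Rightarrow> bool" where
  "tautologous C \<longleftrightarrow> (\<exists>x. Pos x \<in> C \<and> Neg x \<in> C)"

text \<open>The side clauses \<open>C \<or> d\<^sub>1 \<or> \<dots> \<or> d\<^sub>j\<^sub>-\<^sub>1 \<or> compl d\<^sub>j\<close>, one for each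
  position \<open>j\<close> of \<open>ds\<close>; list positions start at 0.\<close>

definition side_clauses :: "'x clause \<Rightarrow> 'x literal list \<Rightarrow> 'x clause list" where
  "side_clauses C ds = map (\<lambda>j. C \<union> set (take j ds) \<union> {compl (ds ! j)}) [0..<length ds]"

definition maxres_consequents ::
    "'x \<Rightarrow> 'x literal list \<Rightarrow> 'x literal list \<Rightarrow> 'x clause list" where
  "maxres_consequents x as bs =
     (set as \<union> set bs)
       # side_clauses ({Pos x} \<union> set as) bs
       @ side_clauses ({Neg x} \<union> set bs) as"

text \<open>The consequents depend on the order in which the literals of the two antecedents are
  listed; every application of the rule is free to choose these orders.\<close>

definition maxres_step :: "'x clause multiset \<Rightarrow> 'x clause multiset \<Rightarrow> bool" where
  "maxres_step F F' \<longleftrightarrow>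
     (\<exists>x as bs. distinct (Pos x # as) \<and> distinct (Neg x # bs) \<and>
        {# set (Pos x # as), set (Neg x # bs) #} \<subseteq># F \<and>
        F' = F - {# set (Pos x # as), set (Neg x # bs) #}
               + filter_mset (\<lambda>C. \<not> tautologous C) (mset (maxres_consequents x as bs)))"

definition maxres_refutation ::
    "'x clause multiset \<Rightarrow> 'x clause multiset list \<Rightarrow> bool" where
  "maxres_refutation F Fs \<longleftrightarrow>
     Fs \<noteq> [] \<and> hd Fs = F \<and> successively maxres_step Fs \<and> {} \<in># last Fs"

text \<open>The size is the number of rule applications, i.e. \<open>s\<close> for \<open>F\<^sub>0, \<dots>, F\<^sub>s\<close>.\<close>

definition refutation_size :: "'x clause multiset list \<Rightarrow> nat" where
  "refutation_size Fs = length Fs - 1"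


section \<open>Pebbling formulas with hints\<close>

text \<open>A directed graph is given by its vertex set \<open>V\<close> and its edge relation \<open>E\<close>.\<close>

definition predecessors :: "'v rel \<Rightarrow> 'v \<Rightarrow> 'v set" where
  "predecessors E w = {u. (u, w) \<in> E}"

definition sources :: "'v set \<Rightarrow> 'v rel \<Rightarrow> 'v set" where
  "sources V E = {v \<in> V. \<forall>u. (u, v) \<notin> E}"

definition sinks :: "'v set \<Rightarrow> 'v rel \<Rightarrow> 'v set" where
  "sinks V E = {v \<in> V. \<forall>w. (v, w) \<notin> E}"

definition siblings :: "'v rel \<Rightarrow> 'v \<Rightarrow> 'v \<Rightarrow> bool" where
  "siblings E u v \<longleftrightarrow> (u, v) \<notin> E\<^sup>* \<and> (v, u) \<notin> E\<^sup>* \<and>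
     predecessors E u \<inter> predecessors E v \<noteq> {}"

text \<open>The graphs for which the pebbling formulas are meant.\<close>

definition pebbling_dag :: "'v set \<Rightarrow> 'v rel \<Rightarrow> bool" where
  "pebbling_dag V E \<longleftrightarrow> finite V \<and> E \<subseteq> V \<times> V \<and> acyclic E \<and>
     (\<exists>z. sinks V E = {z}) \<and> (\<forall>w \<in> V - sources V E. card (predecessors E w) = 2)"

text \<open>The variable \<open>v\<^sub>a\<close> is the pair \<open>(v, a)\<close> with \<open>a \<in> {1, 2}\<close>.\<close>

definition pebhint_or_clauses :: "'v set \<Rightarrow> 'v rel \<Rightarrow> ('v \<times> nat) clause set" where
  "pebhint_or_clauses V E =
     {{Pos (v, 1), Pos (v, 2)} | v. v \<in> sources V E}
   \<union> {{Neg (u, a), Neg (v, b), Pos (w, 1), Pos (w, 2)} | u v w a b.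
        w \<in> V \<and> u \<noteq> v \<and> predecessors E w = {u, v} \<and> a \<in> {1, 2} \<and> b \<in> {1, 2}}
   \<union> {{Neg (z, a)} | z a. z \<in> sinks V E \<and> a \<in> {1, 2}}
   \<union> {{Pos (u, 1), Pos (u, 2), Pos (v, 1), Pos (v, 2)} | u v.
        u \<in> V \<and> v \<in> V \<and> siblings E u v}"

text \<open>Every clause occurs once: exchanging \<open>u\<close> and \<open>v\<close> does not yield a second copy.  Note that
  \<^const>\<open>mset_set\<close> is only meaningful on finite sets, see \<open>finite_pebhint_or_clauses\<close> below.\<close>

definition pebhint_or :: "'v set \<Rightarrow> 'v rel \<Rightarrow> ('v \<times> nat) clause multiset" where
  "pebhint_or V E = mset_set (pebhint_or_clauses V E)"

lemma finite_pebhint_or_clauses: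
  assumes "finite V" "E \<subseteq> V \<times> V"
  shows "finite (pebhint_or_clauses V E)"
proof (rule finite_subset)
  let ?L = "Pos ` (V \<times> {1, 2::nat}) \<union> Neg ` (V \<times> {1, 2::nat})"
  show "finite (Pow ?L)"
    using assms(1) by simp
  have "u \<in> V \<and> v \<in> V" if "predecessors E w = {u, v}" for u v w
    using that assms(2) by (auto simp: predecessors_def)
  then show "pebhint_or_clauses V E \<subseteq> Pow ?L"
    unfolding pebhint_or_clauses_def sources_def sinks_def by auto
qed


section \<open>Pyramid graphs\<close>

definition pyramid_verts :: "nat \<Rightarrow> (nat \<times> nat) set" where
  "pyramid_verts h = {(i, j). i \<le> h \<and> j \<le> h - i}"

definition pyramid_edges :: "nat \<Rightarrow> (nat \<times> nat) rel" where
  "pyramid_edges h =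
     {((i, k), (i + 1, j)) | i j k. (i + 1, j) \<in> pyramid_verts h \<and> (k = j \<or> k = j + 1)}"

lemma sources_pyramid: "sources (pyramid_verts h) (pyramid_edges h) = {(0, j) | j. j \<le> h}"
proof -
  have "i = 0" if "(i, j) \<in> sources (pyramid_verts h) (pyramid_edges h)" for i j
  proof (rule ccontr)
    assume "i \<noteq> 0"
    then have "((i - 1, j), (i, j)) \<in> pyramid_edges h"
      using that by (cases i) (auto simp: sources_def pyramid_edges_def)
    with that show False
      by (auto simp: sources_def)
  qed
  then show ?thesis
    by (fastforce simp: sources_def pyramid_edges_def pyramid_verts_def)
qed

lemma sinks_pyramid: "sinks (pyramid_verts h) (pyramid_edges h) = {(h, 0)}"
proof -
  have "i = h \<and> j = 0" if "(i, j) \<in> sinks (pyramid_verts h) (pyramid_edges h)" for i j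
  proof (rule ccontr)
    assume "\<not> (i = h \<and> j = 0)"
    with that have "i < h" "j \<le> h - i"
      by (auto simp: sinks_def pyramid_verts_def)
    then have "((i, j), (i + 1, if j = 0 then 0 else j - 1)) \<in> pyramid_edges h"
      by (auto simp: pyramid_edges_def pyramid_verts_def)
    with that show False
      by (auto simp: sinks_def)
  qed
  then show ?thesis
    by (auto simp: sinks_def pyramid_edges_def pyramid_verts_def)
qed

lemma predecessors_pyramid:
  assumes "(i + 1, j) \<in> pyramid_verts h"
  shows "predecessors (pyramid_edges h) (i + 1, j) = {(i, j), (i, j + 1)}"
  using assms by (auto simp: predecessors_def pyramid_edges_def)

lemma pebbling_dag_pyramid: "pebbling_dag (pyramid_verts h) (pyramid_edges h)"
  unfolding pebbling_dag_def
proof (intro conjI ballI)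
  show "finite (pyramid_verts h)"
    by (rule finite_subset[of _ "{..h} \<times> {..h}"]) (auto simp: pyramid_verts_def)
  show "pyramid_edges h \<subseteq> pyramid_verts h \<times> pyramid_verts h"
    by (auto simp: pyramid_edges_def pyramid_verts_def)
  have "pyramid_edges h \<subseteq> measure fst"
    by (auto simp: pyramid_edges_def)
  then show "acyclic (pyramid_edges h)"
    using wf_acyclic wf_subset wf_measure by blast
  show "\<exists>z. sinks (pyramid_verts h) (pyramid_edges h) = {z}"
    by (simp add: sinks_pyramid)
next
  fix w assume w: "w \<in> pyramid_verts h - sources (pyramid_verts h) (pyramid_edges h)"
  obtain i j where ij: "w = (i, j)" by fastforce
  with w have "i \<noteq> 0"
    using sources_pyramid[of h] by (auto simp: pyramid_verts_def)
  then obtain i' where "i = i' + 1"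
    by (metis Suc_eq_plus1 not0_implies_Suc)
  with w ij show "card (predecessors (pyramid_edges h) w) = 2"
    using predecessors_pyramid[of i' j h] by simp
qed

end

theory Submission
  imports Defs "HOL-Library.Disjoint_Sets" "HOL-Real_Asymp.Real_Asymp"
begin

text \<open>Write \<open>U v\<close> for \<open>v\<^sub>1 \<or> v\<^sub>2\<close>.  Since a MaxSAT resolution step consumes its antecedents, \<open>U v\<close> cannot be
  used for both successors of \<open>v\<close>.  The pyramid is pebbled layer by layer, each layer from left to
  right.  Deriving \<open>U w\<close> from \<open>U u\<close>, \<open>U v\<close> and the pebbling clauses of \<open>w\<close> leaves the side clauses of
  \<open>U v \<or> \<not> U w\<close>.  The right neighbour \<open>w'\<close> of \<open>w\<close> has the predecessors \<open>v\<close> and \<open>v'\<close>; resolving these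
  side clauses with the hint \<open>U w \<or> U w'\<close> gives \<open>U v \<or> U w'\<close>, which is as good as \<open>U v\<close> for
  deriving \<open>U w'\<close>, and again leaves \<open>U v' \<or> \<not> U w'\<close>.  Each vertex costs constantly many steps.\<close>

section \<open>Derivations with discarded clauses\<close>

text \<open>\<open>J\<close> collects leftover clauses: a refutation only has to contain the empty
  clause at the end, so anything else may be dropped from view. The step count \<open>n\<close> is
  exact, so that the size of the final refutation is known from below as well as from above.\<close>

definition maxres_derives :: "nat \<Rightarrow> 'x clause multiset \<Rightarrow> 'x clause multiset \<Rightarrow> bool" where
  "maxres_derives n F G \<longleftrightarrow> (\<exists>J. (maxres_step ^^ n) F (G + J))"

lemma maxres_step_frame:
  assumes "maxres_step F G"
  shows "maxres_step (F + K) (G + K)"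
proof -
  obtain x as bs where d: "distinct (Pos x # as)" "distinct (Neg x # bs)"
    and le: "{# set (Pos x # as), set (Neg x # bs) #} \<subseteq># F"
    and G: "G = F - {# set (Pos x # as), set (Neg x # bs) #}
       + filter_mset (\<lambda>C. \<not> tautologous C) (mset (maxres_consequents x as bs))"
    using assms unfolding maxres_step_def by blast
  let ?A = "{# set (Pos x # as), set (Neg x # bs) #}"
  have eq: "F + K - ?A = F - ?A + K"
    using le by (metis subset_mset.add_diff_assoc2)
  have le': "?A \<subseteq># F + K"
    using le by (rule subset_mset.order_trans) simp
  show ?thesis
    unfolding maxres_step_def
    by (intro exI[of _ x] exI[of _ as] exI[of _ bs] conjI d le') (simp only: eq G ac_simps)
qed

lemma relpowp_maxres_step_frame:
  "(maxres_step ^^ n) F G \<Longrightarrow> (maxres_step ^^ n) (F + K) (G + K)"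
proof (induction n arbitrary: G)
  case (Suc n)
  then show ?case
    using maxres_step_frame by (metis relpowp_Suc_E relpowp_Suc_I)
qed simp

lemma maxres_derives_refl: "maxres_derives 0 F F"
  unfolding maxres_derives_def by (rule exI[of _ "{#}"]) simp

lemma maxres_derives_frame:
  assumes "maxres_derives n F G"
  shows "maxres_derives n (F + K) (G + K)"
proof -
  obtain J where "(maxres_step ^^ n) F (G + J)"
    using assms unfolding maxres_derives_def by blast
  from relpowp_maxres_step_frame[OF this, of K] show ?thesis
    unfolding maxres_derives_def by (intro exI[of _ J]) (simp add: ac_simps)
qed

lemma maxres_derives_trans:
  assumes "maxres_derives m F G" "maxres_derives n G H"
  shows "maxres_derives (m + n) F H"
proof -
  obtain J where J: "(maxres_step ^^ m) F (G + J)"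
    using assms(1) unfolding maxres_derives_def by blast
  have "maxres_derives n (G + J) (H + J)"
    using assms(2) by (rule maxres_derives_frame)
  then obtain L where "(maxres_step ^^ n) (G + J) (H + J + L)"
    unfolding maxres_derives_def by blast
  with J have "(maxres_step ^^ (m + n)) F (H + (J + L))"
    unfolding relpowp_add by (auto simp: ac_simps)
  then show ?thesis
    unfolding maxres_derives_def by blast
qed

lemma maxres_derives_mono:
  assumes "maxres_derives n F G" "F \<subseteq># F'" "G' \<subseteq># G"
  shows "maxres_derives n F' G'"
proof -
  obtain K L where KL: "F' = F + K" "G = G' + L"
    using assms(2,3) by (metis mset_subset_eq_exists_conv)
  obtain J where "(maxres_step ^^ n) (F + K) (G + K + J)"
    using maxres_derives_frame[OF assms(1), of K] unfolding maxres_derives_def by blast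
  then show ?thesis
    unfolding maxres_derives_def KL by (intro exI[of _ "L + K + J"]) (simp add: ac_simps)
qed

text \<open>The workhorse for chaining local derivations: \<open>K\<close> holds the clauses waiting
  for later steps. Stating the split as an equation leaves the rearrangement of the multiset to the
  simplifier.\<close>

lemma maxres_derives_cut:
  assumes "maxres_derives m F G" "M = F + K" "maxres_derives n (G + K) H"
  shows "maxres_derives (m + n) M H"
  using maxres_derives_trans[OF maxres_derives_frame[OF assms(1)] assms(3)] assms(2) by simp

lemma relpowp_imp_successively:
  "(R ^^ n) x y \<Longrightarrow>
     \<exists>xs. xs \<noteq> [] \<and> hd xs = x \<and> last xs = y \<and> successively R xs \<and> length xs = Suc n"
proof (induction n arbitrary: x)
  case 0
  then show ?case by (intro exI[of _ "[x]"]) simp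
next
  case (Suc n)
  then obtain z where z: "R x z" "(R ^^ n) z y"
    by (meson relpowp_Suc_E2)
  with Suc.IH obtain xs where "xs \<noteq> []" "hd xs = z" "last xs = y" "successively R xs"
    "length xs = Suc n" by blast
  with z show ?case
    by (intro exI[of _ "x # xs"]) (simp add: successively_Cons)
qed

lemma maxres_refutation_of_derives:
  assumes "maxres_derives n F {#{}#}"
  shows "\<exists>Fs. maxres_refutation F Fs \<and> refutation_size Fs = n"
proof -
  obtain J where "(maxres_step ^^ n) F ({#{}#} + J)"
    using assms unfolding maxres_derives_def by blast
  from relpowp_imp_successively[OF this] show ?thesis
    unfolding maxres_refutation_def refutation_size_def by fastforce
qed

section \<open>Local derivations\<close>

lemma side_clauses_Nil [simp]: "side_clauses C [] = []"
  by (simp add: side_clauses_def)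

lemma side_clauses_Cons [simp]:
  "side_clauses C (d # ds) = insert (compl d) C # side_clauses (insert d C) ds"
  by (simp add: side_clauses_def upt_conv_Cons map_Suc_upt[symmetric] comp_def
      del: upt_Suc)

lemma side_clauses_append:
  "side_clauses C (ds @ es) = side_clauses C ds @ side_clauses (C \<union> set ds) es"
  by (induction ds arbitrary: C) simp_all

text \<open>The antecedent with the negated pivot is listed starting with \<open>ds\<close>; only the side clauses
  arising from \<open>ds\<close> are kept.\<close>

lemma maxres_derives_resolve:
  assumes "finite A" "finite B" "Pos x \<notin> A" "Neg x \<notin> B" "distinct ds" "set ds \<subseteq> B"
    and "\<not> tautologous (A \<union> B)" "\<forall>C \<in> set (side_clauses (insert (Pos x) A) ds). \<not> tautologous C"
  shows "maxres_derives 1 {#insert (Pos x) A, insert (Neg x) B#}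
           (add_mset (A \<union> B) (mset (side_clauses (insert (Pos x) A) ds)))"
proof -
  obtain as where as: "set as = A" "distinct as"
    using finite_distinct_list[OF assms(1)] by blast
  obtain es where es: "set es = B - set ds" "distinct es"
    using finite_distinct_list[of "B - set ds"] assms(2) by blast
  \<comment> \<open>The rule leaves the order of literals free; with \<open>ds\<close> in front, its
    side clauses contain no literal of \<open>es\<close>.\<close>
  have B: "set (ds @ es) = B" "distinct (ds @ es)"
    using es assms(5,6) by auto
  let ?J = "filter_mset (\<lambda>C. \<not> tautologous C)
     (mset (side_clauses (insert (Pos x) A \<union> set ds) es @ side_clauses (insert (Neg x) B) as))"
  have f: "filter_mset (\<lambda>C. \<not> tautologous C) (mset (side_clauses (insert (Pos x) A) ds))
      = mset (side_clauses (insert (Pos x) A) ds)"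
    using assms(8) by (simp add: filter_mset_eq_conv)
  have "filter_mset (\<lambda>C. \<not> tautologous C) (mset (maxres_consequents x as (ds @ es)))
     = add_mset (A \<union> B) (mset (side_clauses (insert (Pos x) A) ds)) + ?J"
    using assms(7) f as B unfolding maxres_consequents_def
    by (simp add: side_clauses_append Un_assoc)
  then have "maxres_step {#insert (Pos x) A, insert (Neg x) B#}
     (add_mset (A \<union> B) (mset (side_clauses (insert (Pos x) A) ds)) + ?J)"
    unfolding maxres_step_def using as B assms(3,4)
    by (intro exI[of _ x] exI[of _ as] exI[of _ "ds @ es"]) simp
  then show ?thesis
    unfolding maxres_derives_def by (metis relpowp_1)
qed

text \<open>The set \<open>X\<close> is empty for the leftmost vertex of a layer and \<open>{w\<^sub>1, w\<^sub>2}\<close> for the others.\<close>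

lemma derives_pebble:
  assumes d: "distinct [a1, a2, b1, b2, w1, w2]" and X: "X \<subseteq> {Pos w1, Pos w2}"
  shows "maxres_derives 6
    {# {Pos a1, Pos a2} \<union> X, {Pos b1, Pos b2},
       {Neg a1, Neg b1, Pos w1, Pos w2}, {Neg a1, Neg b2, Pos w1, Pos w2},
       {Neg a2, Neg b1, Pos w1, Pos w2}, {Neg a2, Neg b2, Pos w1, Pos w2} #}
    {# {Pos w1, Pos w2}, {Pos b1, Pos b2, Neg w1}, {Pos b1, Pos b2, Pos w1, Neg w2} #}"
proof -
  have fX: "finite X" using X by (rule finite_subset) simp
  have nX: "Pos a1 \<notin> X" "Pos a2 \<notin> X" "Pos b1 \<notin> X" "Pos b2 \<notin> X" "\<And>x. Neg x \<notin> X"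
    using X d by auto
  \<comment> \<open>The clause on \<open>a1\<close>, \<open>a2\<close> is consumed here but is
    needed again for \<open>b2\<close>. Listing \<open>Neg b1\<close> first keeps a copy of it
    weakened by \<open>Pos b1\<close>.\<close>
  have 1: "maxres_derives 1
      {# {Pos a1, Pos a2} \<union> X, {Neg a1, Neg b1, Pos w1, Pos w2} #}
      {# {Pos a2, Neg b1, Pos w1, Pos w2}, {Pos a1, Pos a2, Pos b1} \<union> X #}"
  proof -
    \<comment> \<open>Every pebbling clause contains \<open>w1\<close> and \<open>w2\<close>, so the
      resolvent absorbs \<open>X\<close>.\<close>
    have "{Pos a2} \<union> X \<union> {Neg b1, Pos w1, Pos w2} = {Pos a2, Neg b1, Pos w1, Pos w2}"
      using X by auto
    moreover have "insert (Pos b1) (insert (Pos a1) ({Pos a2} \<union> X)) = {Pos a1, Pos a2, Pos b1} \<union> X"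
      by auto
    ultimately show ?thesis
      using maxres_derives_resolve[of "{Pos a2} \<union> X" "{Neg b1, Pos w1, Pos w2}" a1 "[Neg b1]"]
        d fX nX by (auto simp: tautologous_def)
  qed
  have 2: "maxres_derives 1
      {# {Pos a2, Neg b1, Pos w1, Pos w2}, {Neg a2, Neg b1, Pos w1, Pos w2} #}
      {# {Neg b1, Pos w1, Pos w2} #}"
    using maxres_derives_resolve[of "{Neg b1, Pos w1, Pos w2}" "{Neg b1, Pos w1, Pos w2}" a2 "[]"] d
    by (auto simp: tautologous_def)
  \<comment> \<open>The weakened copy takes the place of the original; the extra literal
    \<open>Pos b1\<close> does no harm, as it already occurs in the clause used on \<open>b2\<close>
    in the fifth resolution.\<close>
  have 3: "maxres_derives 1
      {# {Pos a1, Pos a2, Pos b1} \<union> X, {Neg a1, Neg b2, Pos w1, Pos w2} #}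
      {# {Pos a2, Pos b1, Neg b2, Pos w1, Pos w2} #}"
  proof -
    have "{Pos a2, Pos b1} \<union> X \<union> {Neg b2, Pos w1, Pos w2} = {Pos a2, Pos b1, Neg b2, Pos w1, Pos w2}"
      using X by auto
    then show ?thesis
      using maxres_derives_resolve[of "{Pos a2, Pos b1} \<union> X" "{Neg b2, Pos w1, Pos w2}" a1 "[]"]
        d fX nX by (auto simp: tautologous_def)
  qed
  have 4: "maxres_derives 1
      {# {Pos a2, Pos b1, Neg b2, Pos w1, Pos w2}, {Neg a2, Neg b2, Pos w1, Pos w2} #}
      {# {Pos b1, Neg b2, Pos w1, Pos w2} #}"
    using maxres_derives_resolve[of "{Pos b1, Neg b2, Pos w1, Pos w2}" "{Neg b2, Pos w1, Pos w2}" a2 "[]"] d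
    by (auto simp: tautologous_def insert_commute)
  \<comment> \<open>Listing \<open>Pos w1\<close>, \<open>Pos w2\<close> first produces exactly the
    two side clauses that pass \<open>b1\<close>, \<open>b2\<close> on to the right neighbour of
    \<open>w\<close>.\<close>
  have 5: "maxres_derives 1
      {# {Pos b1, Pos b2}, {Pos b1, Neg b2, Pos w1, Pos w2} #}
      {# {Pos b1, Pos w1, Pos w2}, {Pos b1, Pos b2, Neg w1}, {Pos b1, Pos b2, Pos w1, Neg w2} #}"
    using maxres_derives_resolve[of "{Pos b1}" "{Pos b1, Pos w1, Pos w2}" b2 "[Pos w1, Pos w2]"] d
    by (auto simp: tautologous_def insert_commute)
  have 6: "maxres_derives 1
      {# {Pos b1, Pos w1, Pos w2}, {Neg b1, Pos w1, Pos w2} #} {# {Pos w1, Pos w2} #}"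
    using maxres_derives_resolve[of "{Pos w1, Pos w2}" "{Pos w1, Pos w2}" b1 "[]"] d
    by (auto simp: tautologous_def)
  have "maxres_derives (1 + (1 + (1 + (1 + (1 + (1 + 0))))))
    {# {Pos a1, Pos a2} \<union> X, {Pos b1, Pos b2},
       {Neg a1, Neg b1, Pos w1, Pos w2}, {Neg a1, Neg b2, Pos w1, Pos w2},
       {Neg a2, Neg b1, Pos w1, Pos w2}, {Neg a2, Neg b2, Pos w1, Pos w2} #}
    {# {Pos w1, Pos w2}, {Pos b1, Pos b2, Neg w1}, {Pos b1, Pos b2, Pos w1, Neg w2} #}"
    apply (rule maxres_derives_cut[OF 1, where K = "{# {Pos b1, Pos b2},
        {Neg a1, Neg b2, Pos w1, Pos w2},
       {Neg a2, Neg b1, Pos w1, Pos w2}, {Neg a2, Neg b2, Pos w1, Pos w2} #}"], simp add: add_mset_commute)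
    apply (rule maxres_derives_cut[OF 2, where K = "{# {Pos b1, Pos b2}, {Pos a1, Pos a2, Pos b1} \<union> X,
        {Neg a1, Neg b2, Pos w1, Pos w2}, {Neg a2, Neg b2, Pos w1, Pos w2} #}"], simp add: add_mset_commute)
    apply (rule maxres_derives_cut[OF 3, where K = "{# {Pos b1, Pos b2}, {Neg b1, Pos w1, Pos w2},
        {Neg a2, Neg b2, Pos w1, Pos w2} #}"], simp add: add_mset_commute)
    apply (rule maxres_derives_cut[OF 4, where K = "{# {Pos b1, Pos b2}, {Neg b1, Pos w1, Pos w2} #}"],
        simp add: add_mset_commute)
    apply (rule maxres_derives_cut[OF 5, where K = "{# {Neg b1, Pos w1, Pos w2} #}"],
        simp add: add_mset_commute)
    apply (rule maxres_derives_cut[OF 6, where K = "{# {Pos b1, Pos b2, Neg w1}, {Pos b1, Pos b2, Pos w1, Neg w2} #}"],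
        simp add: add_mset_commute)
    apply (simp add: maxres_derives_refl add_mset_commute)
    done
  then show ?thesis by (simp add: eval_nat_numeral)
qed

text \<open>Here \<open>p\<close> is the left neighbour of \<open>w\<close> and \<open>a\<close>
  their common predecessor. Two resolutions with the hint recover the clause on \<open>a\<close>,
  weakened by \<open>w1\<close> and \<open>w2\<close>; the remaining six steps are
  \<open>derives_pebble\<close>.\<close>

lemma derives_pebble_hint:
  assumes d: "distinct [a1, a2, b1, b2, p1, p2, w1, w2]"
  shows "maxres_derives 8
    {# {Pos a1, Pos a2, Neg p1}, {Pos a1, Pos a2, Pos p1, Neg p2}, {Pos b1, Pos b2},
       {Pos p1, Pos p2, Pos w1, Pos w2},
       {Neg a1, Neg b1, Pos w1, Pos w2}, {Neg a1, Neg b2, Pos w1, Pos w2},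
       {Neg a2, Neg b1, Pos w1, Pos w2}, {Neg a2, Neg b2, Pos w1, Pos w2} #}
    {# {Pos w1, Pos w2}, {Pos b1, Pos b2, Neg w1}, {Pos b1, Pos b2, Pos w1, Neg w2} #}"
proof -
  let ?P = "{# {Pos b1, Pos b2},
       {Neg a1, Neg b1, Pos w1, Pos w2}, {Neg a1, Neg b2, Pos w1, Pos w2},
       {Neg a2, Neg b1, Pos w1, Pos w2}, {Neg a2, Neg b2, Pos w1, Pos w2} #}"
  \<comment> \<open>The pivot \<open>p2\<close> comes first because the side clause with
    \<open>Neg p2\<close> also contains \<open>Pos p1\<close>, which thus survives for the second
    resolution.\<close>
  have 1: "maxres_derives 1
      {# {Pos p1, Pos p2, Pos w1, Pos w2}, {Pos a1, Pos a2, Pos p1, Neg p2} #}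
      {# {Pos a1, Pos a2, Pos p1, Pos w1, Pos w2} #}"
    using maxres_derives_resolve[of "{Pos p1, Pos w1, Pos w2}" "{Pos a1, Pos a2, Pos p1}" p2 "[]"] d
    by (auto simp: tautologous_def insert_commute)
  have 2: "maxres_derives 1
      {# {Pos a1, Pos a2, Pos p1, Pos w1, Pos w2}, {Pos a1, Pos a2, Neg p1} #}
      {# {Pos a1, Pos a2} \<union> {Pos w1, Pos w2} #}"
    using maxres_derives_resolve[of "{Pos a1, Pos a2, Pos w1, Pos w2}" "{Pos a1, Pos a2}" p1 "[]"] d
    by (auto simp: tautologous_def insert_commute)
  have 3: "maxres_derives 6 ({# {Pos a1, Pos a2} \<union> {Pos w1, Pos w2} #} + ?P)
      {# {Pos w1, Pos w2}, {Pos b1, Pos b2, Neg w1}, {Pos b1, Pos b2, Pos w1, Neg w2} #}"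
    using derives_pebble[of a1 a2 b1 b2 w1 w2 "{Pos w1, Pos w2}"] d
    by (simp add: insert_commute add_mset_commute)
  have "maxres_derives (1 + (1 + 6))
    {# {Pos a1, Pos a2, Neg p1}, {Pos a1, Pos a2, Pos p1, Neg p2}, {Pos b1, Pos b2},
       {Pos p1, Pos p2, Pos w1, Pos w2},
       {Neg a1, Neg b1, Pos w1, Pos w2}, {Neg a1, Neg b2, Pos w1, Pos w2},
       {Neg a2, Neg b1, Pos w1, Pos w2}, {Neg a2, Neg b2, Pos w1, Pos w2} #}
    {# {Pos w1, Pos w2}, {Pos b1, Pos b2, Neg w1}, {Pos b1, Pos b2, Pos w1, Neg w2} #}"
    apply (rule maxres_derives_cut[OF 1, where K = "add_mset {Pos a1, Pos a2, Neg p1} ?P"],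
        simp add: add_mset_commute)
    apply (rule maxres_derives_cut[OF 2 _ 3])
    apply (simp add: add_mset_commute)
    done
  then show ?thesis by simp
qed

lemma derives_empty:
  assumes "x \<noteq> y"
  shows "maxres_derives 2 {# {Pos x, Pos y}, {Neg x}, {Neg y} #} {# {} #}"
proof -
  have 1: "maxres_derives 1 {# {Pos x, Pos y}, {Neg x} #} {# {Pos y} #}"
    using maxres_derives_resolve[of "{Pos y}" "{}" x "[]"] assms by (simp add: tautologous_def)
  have 2: "maxres_derives 1 ({# {Pos y} #} + {# {Neg y} #}) {# {} #}"
    using maxres_derives_resolve[of "{}" "{}" y "[]"] assms by (simp add: tautologous_def add_mset_commute)
  have "maxres_derives (1 + 1) {# {Pos x, Pos y}, {Neg x}, {Neg y} #} {# {} #}"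
    by (rule maxres_derives_cut[OF 1 _ 2]) simp
  then show ?thesis by (simp add: numeral_2_eq_2)
qed

section \<open>The pyramid\<close>

abbreviation or_clause :: "'v \<Rightarrow> ('v \<times> nat) clause" where
  "or_clause v \<equiv> {Pos (v, 1), Pos (v, 2)}"

definition pebble_clauses :: "nat \<Rightarrow> nat \<Rightarrow> ((nat \<times> nat) \<times> nat) clause set" where
  "pebble_clauses i j = {{Neg ((i, j), a), Neg ((i, Suc j), b), Pos ((Suc i, j), 1), Pos ((Suc i, j), 2)}
     | a b. a \<in> {1, 2} \<and> b \<in> {1, 2}}"

definition hint_clause :: "nat \<Rightarrow> nat \<Rightarrow> ((nat \<times> nat) \<times> nat) clause" where
  "hint_clause i j = or_clause (i, j) \<union> or_clause (i, Suc j)"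

abbreviation pebble_clause :: "nat \<Rightarrow> nat \<Rightarrow> nat \<Rightarrow> nat \<Rightarrow> ((nat \<times> nat) \<times> nat) clause" where
  "pebble_clause i j a b \<equiv> {Neg ((i, j), a), Neg ((i, Suc j), b), Pos ((Suc i, j), 1), Pos ((Suc i, j), 2)}"

text \<open>The negative literals determine \<open>a\<close> and \<open>b\<close>, so the set really
  has four elements and each clause is available once.\<close>

lemma mset_pebble_clauses:
  "mset_set (pebble_clauses i j) =
     {# pebble_clause i j 1 1, pebble_clause i j 1 2, pebble_clause i j 2 1, pebble_clause i j 2 2 #}"
proof -
  have inj: "a = c \<and> b = d" if "pebble_clause i j a b = pebble_clause i j c d" for a b c d
  proof -
    have "Neg ((i, j), a) \<in> pebble_clause i j c d" "Neg ((i, Suc j), b) \<in> pebble_clause i j c d"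
      unfolding that[symmetric] by simp_all
    then show ?thesis by simp
  qed
  have ne: "pebble_clause i j a b \<noteq> pebble_clause i j c d" if "a \<noteq> c \<or> b \<noteq> d" for a b c d
    using inj that by blast
  have four: "mset_set {c, d, e, f} = {#c, d, e, f#}"
    if "c \<noteq> d" "c \<noteq> e" "c \<noteq> f" "d \<noteq> e" "d \<noteq> f" "e \<noteq> f"
    for c d e f :: "((nat \<times> nat) \<times> nat) clause"
    using that by simp
  have "pebble_clauses i j =
     {pebble_clause i j 1 1, pebble_clause i j 1 2, pebble_clause i j 2 1, pebble_clause i j 2 2}"
    unfolding pebble_clauses_def by auto
  then show ?thesis
    by (simp only:) (rule four; rule ne; simp)
qed

text \<open>Together, the carry clauses of \<open>u\<close> and \<open>w\<close> are violated once iff \<open>w\<^sub>1 \<or> w\<^sub>2\<close> is true and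
  \<open>u\<^sub>1 \<or> u\<^sub>2\<close> is false.\<close>

abbreviation carry_clauses :: "'v \<Rightarrow> 'v \<Rightarrow> ('v \<times> nat) clause multiset" where
  "carry_clauses u w \<equiv>
     {# {Pos (u, 1), Pos (u, 2), Neg (w, 1)}, {Pos (u, 1), Pos (u, 2), Pos (w, 1), Neg (w, 2)} #}"

text \<open>Invariant of the sweep from left to right: only the carry clauses of the last
  predecessor remain to feed the next vertex. The leftmost vertex has no left neighbour and costs 6
  steps, every further one 8.\<close>

lemma derives_layer_prefix:
  "maxres_derives (6 + 8 * k)
     ((\<Sum>j\<le>Suc k. {#or_clause (i, j)#}) + (\<Sum>j\<le>k. mset_set (pebble_clauses i j))
       + (\<Sum>j<k. {#hint_clause (Suc i) j#}))
     ((\<Sum>j\<le>k. {#or_clause (Suc i, j)#}) + carry_clauses (i, Suc k) (Suc i, k))"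
proof (induction k)
  case 0
  show ?case
    using derives_pebble[of "((i, 0), 1::nat)" "((i, 0), 2)" "((i, Suc 0), 1)" "((i, Suc 0), 2)"
        "((Suc i, 0), 1)" "((Suc i, 0), 2)" "{}"]
    by (simp add: mset_pebble_clauses add_mset_commute)
next
  case (Suc k)
  \<comment> \<open>The clauses that are newly touched when vertex \<open>(Suc i, Suc k)\<close> is
    pebbled.\<close>
  let ?N = "{# or_clause (i, Suc (Suc k)), hint_clause (Suc i) k #} + mset_set (pebble_clauses i (Suc k))"
  let ?W = "\<Sum>j\<le>k. {#or_clause (Suc i, j)#}"
  let ?G = "{# or_clause (Suc i, Suc k) #} + carry_clauses (i, Suc (Suc k)) (Suc i, Suc k)"
  have hint: "hint_clause (Suc i) k = {Pos ((Suc i, k), 1), Pos ((Suc i, k), 2),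
      Pos ((Suc i, Suc k), 1), Pos ((Suc i, Suc k), 2)}"
    unfolding hint_clause_def by blast
  have s: "maxres_derives 8 (carry_clauses (i, Suc k) (Suc i, k) + ?N) ?G"
    using derives_pebble_hint[of "((i, Suc k), 1::nat)" "((i, Suc k), 2)"
        "((i, Suc (Suc k)), 1)" "((i, Suc (Suc k)), 2)" "((Suc i, k), 1)" "((Suc i, k), 2)"
        "((Suc i, Suc k), 1)" "((Suc i, Suc k), 2)"]
    by (simp add: mset_pebble_clauses hint add_mset_commute)
  have "maxres_derives (6 + 8 * k + 8)
     ((\<Sum>j\<le>Suc (Suc k). {#or_clause (i, j)#}) + (\<Sum>j\<le>Suc k. mset_set (pebble_clauses i j))
       + (\<Sum>j<Suc k. {#hint_clause (Suc i) j#})) (?W + ?G)"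
  proof (rule maxres_derives_cut[OF Suc.IH, where K = ?N])
    show "maxres_derives 8 (?W + carry_clauses (i, Suc k) (Suc i, k) + ?N) (?W + ?G)"
      using maxres_derives_frame[OF s, of ?W] by (simp only: ac_simps)
  qed simp
  moreover have "6 + 8 * k + 8 = 6 + 8 * Suc k" by simp
  moreover have "?W + ?G = (\<Sum>j\<le>Suc k. {#or_clause (Suc i, j)#})
      + carry_clauses (i, Suc (Suc k)) (Suc i, Suc k)"
    by simp
  ultimately show ?case
    by (simp only:)
qed

text \<open>The parameter \<open>m\<close> counts the vertices of layer \<open>Suc i\<close>, whence
  the \<open>m - 1\<close> pairs of neighbours.\<close>

definition layer_clauses :: "nat \<Rightarrow> nat \<Rightarrow> ((nat \<times> nat) \<times> nat) clause multiset" where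
  "layer_clauses i m = (\<Sum>j<m. mset_set (pebble_clauses i j)) + (\<Sum>j<m - 1. {#hint_clause (Suc i) j#})"

lemma derives_layer:
  assumes "0 < m"
  shows "maxres_derives (8 * m - 2) ((\<Sum>j\<le>m. {#or_clause (i, j)#}) + layer_clauses i m)
           (\<Sum>j<m. {#or_clause (Suc i, j)#})"
proof -
  obtain k where m: "m = Suc k"
    using assms by (cases m) auto
  have "maxres_derives (6 + 8 * k) ((\<Sum>j\<le>m. {#or_clause (i, j)#}) + layer_clauses i m)
     (\<Sum>j<m. {#or_clause (Suc i, j)#})"
    by (rule maxres_derives_mono[OF derives_layer_prefix[of k i]])
      (simp_all add: m layer_clauses_def lessThan_Suc_atMost add.assoc)
  then show ?thesis
    by (simp add: m)
qed

text \<open>A completed layer supplies the clauses that the next layer starts from, and each layer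
  brings its own pebbling clauses and hints, so the layers chain.\<close>

lemma derives_layers:
  "k \<le> h \<Longrightarrow> maxres_derives (\<Sum>i<k. 8 * (h - i) - 2)
     ((\<Sum>j\<le>h. {#or_clause (0, j)#}) + (\<Sum>i<k. layer_clauses i (h - i)))
     (\<Sum>j\<le>h - k. {#or_clause (k, j)#})"
proof (induction k)
  case 0
  then show ?case by (simp add: maxres_derives_refl)
next
  case (Suc k)
  have "maxres_derives ((\<Sum>i<k. 8 * (h - i) - 2) + (8 * (h - k) - 2))
     ((\<Sum>j\<le>h. {#or_clause (0, j)#}) + (\<Sum>i<Suc k. layer_clauses i (h - i)))
     (\<Sum>j<h - k. {#or_clause (Suc k, j)#})"
    by (rule maxres_derives_cut[OF Suc.IH, where K = "layer_clauses k (h - k)"])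
      (use Suc.prems derives_layer[of "h - k" k] in \<open>simp_all add: add.assoc\<close>)
  moreover have "{..<h - k} = {..h - Suc k}"
    using Suc.prems by auto
  ultimately show ?case
    by simp
qed

lemma sum_layer_sizes: "(\<Sum>i<h. 8 * (h - i) - 2) = 4 * h\<^sup>2 + 2 * (h::nat)"
proof -
  \<comment> \<open>The rewriting relies on \<open>i < h\<close>, which keeps the truncated
    subtraction exact; the sum can then be reversed.\<close>
  have "(\<Sum>i<h. 8 * (h - i) - 2) = (\<Sum>i<h. 6 + 8 * (h - Suc i))"
    by (rule sum.cong) auto
  also have "\<dots> = (\<Sum>i<h. 6 + 8 * i)"
    by (rule sum.nat_diff_reindex[of "\<lambda>i. 6 + 8 * i"])
  also have "\<dots> = 4 * h\<^sup>2 + 2 * h"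
    by (induction h) (simp_all add: power2_eq_square)
  finally show ?thesis .
qed

section \<open>Availability of the consumed clauses in the formula\<close>

lemma add_subseteq_mset_set_Un:
  assumes "A \<subseteq># mset_set S" "B \<subseteq># mset_set T" "finite S" "finite T" "S \<inter> T = {}"
  shows "A + B \<subseteq># mset_set (S \<union> T)"
  using assms by (simp add: mset_set_Union subset_mset.add_mono)

text \<open>The formula holds each clause once while the derivation consumes a sum of multisets;
  disjointness ensures that no clause is counted twice.\<close>

lemma sum_subseteq_mset_set_UN:
  assumes "finite I" "\<And>i. i \<in> I \<Longrightarrow> finite (S i)"
    and "\<And>i. i \<in> I \<Longrightarrow> M i \<subseteq># mset_set (S i)" "disjoint_family_on S I"
  shows "(\<Sum>i\<in>I. M i) \<subseteq># mset_set (\<Union>i\<in>I. S i)"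
  using assms
proof (induction I rule: finite_induct)
  case (insert x I)
  have "S x \<inter> (\<Union>i\<in>I. S i) = {}"
    using insert.hyps insert.prems(3) by (fastforce simp: disjoint_family_on_def)
  moreover have "(\<Sum>i\<in>I. M i) \<subseteq># mset_set (\<Union>i\<in>I. S i)"
    using insert by (simp add: disjoint_family_on_def)
  ultimately show ?case
    using insert add_subseteq_mset_set_Un[of "M x" "S x" "\<Sum>i\<in>I. M i" "\<Union>i\<in>I. S i"] by simp
qed simp

definition layer_clause_set :: "nat \<Rightarrow> nat \<Rightarrow> ((nat \<times> nat) \<times> nat) clause set" where
  "layer_clause_set i m = (\<Union>j<m. pebble_clauses i j) \<union> (\<Union>j<m - 1. {hint_clause (Suc i) j})"

lemma finite_pebble_clauses: "finite (pebble_clauses i j)"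
  unfolding pebble_clauses_def by (rule finite_subset[of _
    "(\<lambda>(a, b). pebble_clause i j a b) ` ({1, 2} \<times> {1, 2})"]) auto

lemma finite_layer_clause_set: "finite (layer_clause_set i m)"
  unfolding layer_clause_set_def using finite_pebble_clauses by auto

lemma pebble_clauses_Pos_iff:
  "C \<in> pebble_clauses i j \<Longrightarrow> Pos (v, 1) \<in> C \<longleftrightarrow> v = (Suc i, j)"
  by (auto simp: pebble_clauses_def)

lemma hint_clause_Pos_iff:
  "Pos (v, 1) \<in> hint_clause i j \<longleftrightarrow> v = (i, j) \<or> v = (i, Suc j)"
  by (auto simp: hint_clause_def)

lemma hint_clause_inj: "hint_clause i j = hint_clause i k \<Longrightarrow> j = k"
  using hint_clause_Pos_iff[of "(i, j)" i k] hint_clause_Pos_iff[of "(i, k)" i j]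
    hint_clause_Pos_iff[of "(i, j)" i j] hint_clause_Pos_iff[of "(i, k)" i k] by auto

text \<open>The layer of the positive literals identifies the layer set of a clause. This separates
  different layers from each other, from the source clauses in layer 0 and from the negative sink
  clauses.\<close>

lemma layer_clause_set_Pos:
  assumes "C \<in> layer_clause_set i m"
  shows "\<exists>j. Pos ((Suc i, j), 1) \<in> C" "Pos ((k, l), 1) \<in> C \<Longrightarrow> k = Suc i"
  using assms unfolding layer_clause_set_def
  by (auto simp: pebble_clauses_Pos_iff[simplified] hint_clause_Pos_iff[simplified])

lemma layer_clauses_subseteq: "layer_clauses i m \<subseteq># mset_set (layer_clause_set i m)"
  unfolding layer_clauses_def layer_clause_set_def
proof (rule add_subseteq_mset_set_Un)
  show "(\<Sum>j<m. mset_set (pebble_clauses i j)) \<subseteq># mset_set (\<Union>j<m. pebble_clauses i j)"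
  proof (rule sum_subseteq_mset_set_UN)
    show "disjoint_family_on (pebble_clauses i) {..<m}"
      unfolding disjoint_family_on_def
    proof (intro ballI impI equals0I)
      fix j k C assume "j \<noteq> k" "C \<in> pebble_clauses i j \<inter> pebble_clauses i k"
      then show False
        using pebble_clauses_Pos_iff[of C i j "(Suc i, j)"] pebble_clauses_Pos_iff[of C i k "(Suc i, j)"]
        by simp
    qed
  qed (simp_all add: finite_pebble_clauses)
  show "(\<Sum>j<m - 1. {#hint_clause (Suc i) j#}) \<subseteq># mset_set (\<Union>j<m - 1. {hint_clause (Suc i) j})"
    by (rule sum_subseteq_mset_set_UN) (auto simp: disjoint_family_on_def dest: hint_clause_inj)
  \<comment> \<open>Pebbling clauses have negative literals, hints have none.\<close>
  have "C \<noteq> hint_clause (Suc i) k" if C: "C \<in> pebble_clauses i j" for C j k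
  proof -
    obtain v where "Neg v \<in> C"
      using C by (auto simp: pebble_clauses_def)
    moreover have "Neg v \<notin> hint_clause (Suc i) k"
      by (simp add: hint_clause_def)
    ultimately show ?thesis by blast
  qed
  then show "(\<Union>j<m. pebble_clauses i j) \<inter> (\<Union>j<m - 1. {hint_clause (Suc i) j}) = {}"
    by blast
qed (simp_all add: finite_pebble_clauses)

text \<open>Every edge goes up one layer. Hence distinct vertices of one layer are incomparable, as
  siblings must be.\<close>

lemma rtrancl_pyramid_edges: "(u, v) \<in> (pyramid_edges h)\<^sup>* \<Longrightarrow> u = v \<or> fst u < fst v"
  by (induction rule: rtrancl_induct) (auto simp: pyramid_edges_def)

lemma siblings_pyramid:
  assumes "Suc i + Suc j \<le> h"
  shows "siblings (pyramid_edges h) (Suc i, j) (Suc i, Suc j)"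
proof -
  have "(i, Suc j) \<in> predecessors (pyramid_edges h) (Suc i, j)
      \<inter> predecessors (pyramid_edges h) (Suc i, Suc j)"
    using assms by (auto simp: predecessors_def pyramid_edges_def pyramid_verts_def)
  then show ?thesis
    unfolding siblings_def using rtrancl_pyramid_edges by fastforce
qed

lemma layer_clause_set_subset:
  assumes "i < h"
  shows "layer_clause_set i (h - i) \<subseteq> pebhint_or_clauses (pyramid_verts h) (pyramid_edges h)"
proof -
  have "C \<in> pebhint_or_clauses (pyramid_verts h) (pyramid_edges h)"
    if C: "C \<in> pebble_clauses i j" and j: "j < h - i" for C j
  proof -
    have w: "(Suc i, j) \<in> pyramid_verts h"
      using j by (auto simp: pyramid_verts_def)
    then have "predecessors (pyramid_edges h) (Suc i, j) = {(i, j), (i, Suc j)}"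
      using predecessors_pyramid[of i j h] by simp
    moreover have "(i, j) \<noteq> (i, Suc j)" by simp
    ultimately show ?thesis
      using C w unfolding pebble_clauses_def pebhint_or_clauses_def by blast
  qed
  moreover have "hint_clause (Suc i) j \<in> pebhint_or_clauses (pyramid_verts h) (pyramid_edges h)"
    if j: "j < h - i - 1" for j
  proof -
    have "siblings (pyramid_edges h) (Suc i, j) (Suc i, Suc j)"
      using j by (intro siblings_pyramid) simp
    moreover have "(Suc i, j) \<in> pyramid_verts h" "(Suc i, Suc j) \<in> pyramid_verts h"
      using j by (auto simp: pyramid_verts_def)
    moreover have "hint_clause (Suc i) j = {Pos ((Suc i, j), 1), Pos ((Suc i, j), 2),
        Pos ((Suc i, Suc j), 1), Pos ((Suc i, Suc j), 2)}"
      unfolding hint_clause_def by blast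
    ultimately show ?thesis
      unfolding pebhint_or_clauses_def by blast
  qed
  ultimately show ?thesis
    unfolding layer_clause_set_def by auto
qed

lemma pyramid_clauses_subseteq:
  "(\<Sum>j\<le>h. {#or_clause (0, j)#}) + (\<Sum>i<h. layer_clauses i (h - i))
     + {# {Neg ((h, 0), 1)}, {Neg ((h, 0), 2)} #}
   \<subseteq># pebhint_or (pyramid_verts h) (pyramid_edges h)"
proof -
  let ?O = "\<Union>j\<le>h. {or_clause (0::nat, j)}" and ?L = "\<Union>i<h. layer_clause_set i (h - i)"
  let ?Z = "{{Neg ((h, 0::nat), 1::nat)}, {Neg ((h, 0), 2)}}"
  let ?F = "pebhint_or_clauses (pyramid_verts h) (pyramid_edges h)"
  have O: "(\<Sum>j\<le>h. {#or_clause (0::nat, j)#}) \<subseteq># mset_set ?O"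
    by (rule sum_subseteq_mset_set_UN) (auto simp: disjoint_family_on_def doubleton_eq_iff)
  have L: "(\<Sum>i<h. layer_clauses i (h - i)) \<subseteq># mset_set ?L"
  proof (rule sum_subseteq_mset_set_UN)
    show "disjoint_family_on (\<lambda>i. layer_clause_set i (h - i)) {..<h}"
      unfolding disjoint_family_on_def using layer_clause_set_Pos by blast
  qed (simp_all add: finite_layer_clause_set layer_clauses_subseteq)
  have "?O \<inter> ?L = {}"
    using layer_clause_set_Pos(1) by fastforce
  moreover have "(?O \<union> ?L) \<inter> ?Z = {}"
    using layer_clause_set_Pos(1) by fastforce
  ultimately have "(\<Sum>j\<le>h. {#or_clause (0, j)#}) + (\<Sum>i<h. layer_clauses i (h - i))
     + {# {Neg ((h, 0), 1)}, {Neg ((h, 0), 2)} #} \<subseteq># mset_set (?O \<union> ?L \<union> ?Z)"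
    by (intro add_subseteq_mset_set_Un O L) (auto simp: finite_layer_clause_set)
  also have "mset_set (?O \<union> ?L \<union> ?Z) \<subseteq># mset_set ?F"
  proof (rule subset_imp_msubset_mset_set)
    show "finite ?F"
      using pebbling_dag_pyramid[of h] unfolding pebbling_dag_def
      by (intro finite_pebhint_or_clauses) auto
    have "or_clause (0, j) \<in> ?F" if "j \<le> h" for j
    proof -
      have "(0, j) \<in> sources (pyramid_verts h) (pyramid_edges h)"
        using that by (simp add: sources_pyramid)
      then show ?thesis
        unfolding pebhint_or_clauses_def by (intro UnI1) blast
    qed
    then have "?O \<subseteq> ?F" by auto
    moreover have "?L \<subseteq> ?F"
      using layer_clause_set_subset by (intro UN_least) simp
    moreover have "{Neg ((h, 0), a)} \<in> ?F" if "a \<in> {1, 2}" for a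
    proof -
      have "(h, 0) \<in> sinks (pyramid_verts h) (pyramid_edges h)"
        by (simp add: sinks_pyramid)
      then show ?thesis
        unfolding pebhint_or_clauses_def using that by (intro UnI1[OF UnI2]) blast
    qed
    then have "?Z \<subseteq> ?F" by simp
    ultimately show "?O \<union> ?L \<union> ?Z \<subseteq> ?F" by simp
  qed
  finally show ?thesis
    unfolding pebhint_or_def .
qed

lemma derives_pyramid:
  "maxres_derives (4 * h\<^sup>2 + 2 * h + 2) (pebhint_or (pyramid_verts h) (pyramid_edges h)) {#{}#}"
proof -
  have "maxres_derives ((\<Sum>i<h. 8 * (h - i) - 2) + 2)
     ((\<Sum>j\<le>h. {#or_clause (0, j)#}) + (\<Sum>i<h. layer_clauses i (h - i))
        + {# {Neg ((h, 0), 1)}, {Neg ((h, 0), 2)} #}) {#{}#}"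
    \<comment> \<open>With \<open>k = h\<close> only the clause of the sink \<open>(h, 0)\<close> is
      left, which the two negative unit clauses refute.\<close>
    by (rule maxres_derives_cut[OF derives_layers[OF order_refl] refl])
      (use derives_empty[of "((h, 0::nat), 1::nat)" "((h, 0), 2)"] in \<open>simp add: add_mset_commute\<close>)
  then show ?thesis
    unfolding sum_layer_sizes
    by (rule maxres_derives_mono[OF _ pyramid_clauses_subseteq]) simp
qed

section \<open>Vertex count and asymptotics\<close>

lemma card_pyramid_verts: "real (card (pyramid_verts h)) = (real h + 1) * (real h + 2) / 2"
proof -
  have "pyramid_verts h = (SIGMA i:{..h}. {..h - i})"
    by (auto simp: pyramid_verts_def)
  \<comment> \<open>Layer \<open>i\<close> has \<open>Suc (h - i)\<close> vertices; the summand is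
    written in the shape that the reversal of the sum expects.\<close>
  then have "card (pyramid_verts h) = (\<Sum>i<Suc h. Suc (Suc h - Suc i))"
    by (simp add: card_SigmaI lessThan_Suc_atMost)
  also have "\<dots> = (\<Sum>i<Suc h. Suc i)"
    by (rule sum.nat_diff_reindex)
  finally have "real (card (pyramid_verts h)) = real (\<Sum>i<Suc h. Suc i)"
    by (rule arg_cong)
  also have "\<dots> = (real h + 1) * (real h + 2) / 2"
    by (induction h) (simp_all add: field_simps)
  finally show ?thesis .
qed

theorem lemma3p2:
  "(\<lambda>h::nat. real (card (pyramid_verts h))) \<in> \<Theta>(\<lambda>h. real h ^ 2) \<and>
   (\<exists>R :: nat \<Rightarrow> ((nat \<times> nat) \<times> nat) clause multiset list.
      (\<forall>h. maxres_refutation (pebhint_or (pyramid_verts h) (pyramid_edges h)) (R h)) \<and>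
      (\<lambda>h. real (refutation_size (R h))) \<in> \<Theta>(\<lambda>h. real (card (pyramid_verts h))))"
proof -
  have card: "(\<lambda>h::nat. real (card (pyramid_verts h))) \<in> \<Theta>(\<lambda>h. real h ^ 2)"
    unfolding card_pyramid_verts by real_asymp
  \<comment> \<open>One refutation is chosen for every height. Its size is known exactly, so both
    bounds of the Theta claim follow from the same formula.\<close>
  obtain R :: "nat \<Rightarrow> ((nat \<times> nat) \<times> nat) clause multiset list" where
    R: "\<And>h. maxres_refutation (pebhint_or (pyramid_verts h) (pyramid_edges h)) (R h)"
       "\<And>h. refutation_size (R h) = 4 * h\<^sup>2 + 2 * h + 2"
    using maxres_refutation_of_derives[OF derives_pyramid] by metis
  have "(\<lambda>h. real (refutation_size (R h))) \<in> \<Theta>(\<lambda>h. real h ^ 2)"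
    unfolding R(2) of_nat_add of_nat_mult of_nat_power by real_asymp
  also have "\<Theta>(\<lambda>h. real h ^ 2) = \<Theta>(\<lambda>h. real (card (pyramid_verts h)))"
    using card by (metis landau_theta.cong_bigtheta)
  finally show ?thesis
    using card R(1) by blast
qed

end
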